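(* Suppose the following two conditions hold. (i) (Strong Exponential Stability) There exist constants $K_0,\tilde\lambda>0$ such that $\|\mathcal P_t f\|_{\mathcal C^2_b}\le K_0\,\|f\|_{\mathcal C^2_b}\,e^{-\tilde\lambda t}$ for every $t\ge 0$ and every $f\in\mathcal C^2_b(\mathbb R^N)$. (ii) (Local consistency and a-priori control) There exist functions $\phi,\Phi:\mathbb R^N\times\mathbb R^+\to[0,+\infty)$ and a constant $K_1>0$ such that $$\left|\mathbb E_x\left[f(\mathcal X^\delta_\delta)-f(x_\delta)\right]\right|\le K_1\|f\|_{\mathcal C^2_b}\,\phi(x,\delta)$$ for every $x\in\mathbb R^N$, $f\in\mathcal C^2_b(\mathbb R^N)$ and $\delta>0$, and such that $$\sup_{n\in\mathbb N}\mathbb E_x\left[\phi(\mathcal X^\delta_{t_n},\delta)\right]\le\Phi(x,\delta)$$ for every $x\in\mathbb R^N$ and every $\delta>0$ small enough (i.e. for all $\delta\in(0,\delta_0)$ for some $\delta_0>0$). Then, with $K:=K_1(K_0\vee 1)$, for every $x\in\mathbb R^N$, every $f\in\mathcal C^2_b(\mathbb R^N)$ and every $\delta>0$ small enough (i.e. $\delta\in(0,\delta_0)$), $$\sup_{n\in\mathbb N}\left|\mathbb E_x f(\mathcal X^\delta_{t_n})-\mathbb E_x f(x_{t_n})\right|\le\frac{K\,\|f\|_{\mathcal C^2_b}\,\Phi(x,\delta)}{1-e^{-\tilde\lambda\delta}}.$$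
   Context: Let $x_t\in\mathbb R^N$ solve the (It\^o) SDE $dx_t=U_0(x_t)\,dt+\sqrt2\sum_{i=1}^d V_i(x_t)\,dB^i_t$, $x_0=x$, where $U_0,V_1,\dots,V_d$ are smooth vector fields on $\mathbb R^N$ and $B^1,\dots,B^d$ are independent one-dimensional standard Brownian motions. Its Markov semigroup is $(\mathcal P_tf)(x):=\mathbb E[f(x_t)\mid x_0=x]$. For each $\delta>0$, let $\{\mathcal X^\delta_{t_n}\}_{n\in\mathbb N}$, $t_n=n\delta$, be a discrete-time (time-homogeneous) Markov process on $\mathbb R^N$ with time step $\delta$; $\mathcal X^\delta_\delta=\mathcal X^\delta_{t_1}$. $\mathbb E_x$ denotes expectation conditional on the process at hand starting at $x$ at time $0$. $\mathcal C^2_b(\mathbb R^N)$ is the space of real-valued twice continuously differentiable functions with bounded first and second derivatives (the functions themselves need not be bounded), with seminorm $\|f\|_{\mathcal C^2_b}:=\sup_{x}\left(|\nabla f(x)|+\|\nabla^2f(x)\|\right)$, where $\|A\|=\sqrt{\sum_{i,j}|a_{ij}|^2}$ is the Frobenius norm. The semigroup $\mathcal P_t$ and the expectations $\mathbb E_x f(\mathcal X^\delta_{t_n})$ are assumed well defined on $\mathcal C^2_b(\mathbb R^N)$. $a\vee b=\max\{a,b\}$. *)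

theory Defs
  imports "HOL-Probability.Probability"
begin

section \<open>Functions of class \<open>C\<^sup>k\<close> and the space \<open>C\<^sup>2\<^sub>b\<close>\<close>

definition partial :: "'n \<Rightarrow> (real ^ 'n \<Rightarrow> 'b) \<Rightarrow> real ^ 'n \<Rightarrow> 'b::real_normed_vector"
  where "partial i f x = frechet_derivative f (at x) (axis i 1)"

primrec Ck :: "nat \<Rightarrow> (real ^ 'n \<Rightarrow> 'b::real_normed_vector) \<Rightarrow> bool"
  where
    "Ck 0 f \<longleftrightarrow> continuous_on UNIV f"
  | "Ck (Suc k) f \<longleftrightarrow> (\<forall>x. f differentiable (at x)) \<and> (\<forall>i. Ck k (partial i f))"

definition smooth :: "(real ^ 'n \<Rightarrow> 'b::real_normed_vector) \<Rightarrow> bool"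
  where "smooth f \<longleftrightarrow> (\<forall>k. Ck k f)"

definition grad :: "(real ^ 'n \<Rightarrow> real) \<Rightarrow> real ^ 'n \<Rightarrow> real ^ 'n"
  where "grad f x = (\<chi> i. partial i f x)"

definition hessian :: "(real ^ 'n \<Rightarrow> real) \<Rightarrow> real ^ 'n \<Rightarrow> real ^ 'n ^ 'n"
  where "hessian f x = (\<chi> i j. partial i (partial j f) x)"

definition C2b :: "(real ^ 'n \<Rightarrow> real) set"
  where "C2b = {f. Ck 2 f \<and> bounded (range (grad f)) \<and> bounded (range (hessian f))}"

text \<open>
  The norm of type \<^typ>\<open>real ^ 'n ^ 'n\<close> is the Euclidean norm of the vector of row norms, that is,
  the Frobenius norm.  The supremum is meaningful on \<^const>\<open>C2b\<close> only, since
  \<^const>\<open>Sup\<close> is unspecified on unbounded sets of reals.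
\<close>

definition C2b_norm :: "(real ^ 'n \<Rightarrow> real) \<Rightarrow> real"
  where "C2b_norm f = (SUP x. norm (grad f x) + norm (hessian f x))"


section \<open>Time-homogeneous Markov processes\<close>

text \<open>
  A process with an arbitrary starting point is a family: \<open>M x\<close> is the probability space carrying
  the process \<open>X x\<close> started at \<open>x\<close>.  This covers both a single process under a family of measures
  (\<open>X\<close> not depending on \<open>x\<close>) and a family of processes on one space (\<open>M\<close> not depending on \<open>x\<close>).
\<close>

definition law :: "('a \<Rightarrow> 'w measure) \<Rightarrow> ('a \<Rightarrow> 't \<Rightarrow> 'w \<Rightarrow> 'a) \<Rightarrow> 't \<Rightarrow> 'a \<Rightarrow> 'a::topological_space measure"
  where "law M X t x = distr (M x) borel (X x t)"

text \<open>\<open>expect M X t f x\<close> is \<open>E\<^sub>x f(X\<^sub>t)\<close>; as an operator on \<open>f\<close> it is the Markov semigroup at time \<open>t\<close>.\<close>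

definition expect :: "('a \<Rightarrow> 'w measure) \<Rightarrow> ('a \<Rightarrow> 't \<Rightarrow> 'w \<Rightarrow> 'a) \<Rightarrow> 't \<Rightarrow> ('a \<Rightarrow> real) \<Rightarrow> 'a \<Rightarrow> real"
  where "expect M X t f x = (\<integral>\<omega>. f (X x t \<omega>) \<partial>M x)"

definition generated :: "'w measure \<Rightarrow> 't set \<Rightarrow> ('t \<Rightarrow> 'w \<Rightarrow> 'a::topological_space) \<Rightarrow> 'w measure"
  where "generated M T Y = sigma (space M) (\<Union>t\<in>T. {Y t -` A \<inter> space M | A. A \<in> sets borel})"

definition markov_process ::
  "'t set \<Rightarrow> ('a \<Rightarrow> 'w measure) \<Rightarrow> ('a \<Rightarrow> 't::{ord, monoid_add} \<Rightarrow> 'w \<Rightarrow> 'a::topological_space) \<Rightarrow> bool"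
  where "markov_process T M X \<longleftrightarrow>
    (\<forall>x. prob_space (M x)) \<and>
    (\<forall>x. \<forall>t\<in>T. X x t \<in> borel_measurable (M x)) \<and>
    (\<forall>x. AE \<omega> in M x. X x 0 \<omega> = x) \<and>
    (\<forall>t\<in>T. law M X t \<in> borel \<rightarrow>\<^sub>M prob_algebra borel) \<and>
    (\<forall>x. \<forall>s\<in>T. \<forall>t\<in>T. \<forall>A\<in>sets borel.
      AE \<omega> in M x.
        real_cond_exp (M x) (generated (M x) {u \<in> T. u \<le> s} (X x)) (\<lambda>\<omega>'. indicator A (X x (s + t) \<omega>')) \<omega>
        = measure (law M X t (X x s \<omega>)) A)"


section \<open>Brownian motion and the It\^o integral\<close>

definition filtered_prob_space :: "'w measure \<Rightarrow> (real \<Rightarrow> 'w measure) \<Rightarrow> bool"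
  where "filtered_prob_space M F \<longleftrightarrow>
    prob_space M \<and> filtration (space M) F \<and> (\<forall>t. subalgebra M (F t))"

definition brownian_motion :: "'w measure \<Rightarrow> (real \<Rightarrow> 'w measure) \<Rightarrow> (real \<Rightarrow> 'w \<Rightarrow> real) \<Rightarrow> bool"
  where "brownian_motion M F B \<longleftrightarrow>
    (\<forall>t\<ge>0. B t \<in> borel_measurable (F t)) \<and>
    (AE \<omega> in M. B 0 \<omega> = 0) \<and>
    (AE \<omega> in M. continuous_on {0..} (\<lambda>t. B t \<omega>)) \<and>
    (\<forall>s t. 0 \<le> s \<and> s < t \<longrightarrow>
      distributed M lborel (\<lambda>\<omega>. B t \<omega> - B s \<omega>) (\<lambda>z. ennreal (normal_density 0 (sqrt (t - s)) z)) \<and>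
      prob_space.indep_set M (sets (F s)) {(\<lambda>\<omega>. B t \<omega> - B s \<omega>) -` A \<inter> space M | A. A \<in> sets borel})"

definition independent_brownian_motions ::
  "'w measure \<Rightarrow> (real \<Rightarrow> 'w measure) \<Rightarrow> nat \<Rightarrow> (nat \<Rightarrow> real \<Rightarrow> 'w \<Rightarrow> real) \<Rightarrow> bool"
  where "independent_brownian_motions M F d B \<longleftrightarrow>
    (\<forall>i\<in>{1..d}. brownian_motion M F (B i)) \<and>
    prob_space.indep_sets M (\<lambda>i. sets (generated M {0..} (B i))) {1..d}"

definition progressively_measurable ::
  "(real \<Rightarrow> 'w measure) \<Rightarrow> (real \<Rightarrow> 'w \<Rightarrow> 'b::topological_space) \<Rightarrow> bool"
  where "progressively_measurable F H \<longleftrightarrow>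
    (\<forall>t\<ge>0. (\<lambda>(s, \<omega>). H s \<omega>) \<in> borel_measurable (restrict_space borel {0..t} \<Otimes>\<^sub>M F t))"

text \<open>
  The data \<open>m\<close>, \<open>\<tau>\<close>, \<open>\<xi>\<close> encode the simple process equal to \<open>\<xi> k\<close> on the time interval
  from \<open>\<tau> k\<close> (exclusive) to \<open>\<tau> (k + 1)\<close> (inclusive) for \<open>k < m\<close>, and to \<open>0\<close> elsewhere.
\<close>

definition simple_process ::
  "'w measure \<Rightarrow> (real \<Rightarrow> 'w measure) \<Rightarrow> nat \<Rightarrow> (nat \<Rightarrow> real) \<Rightarrow> (nat \<Rightarrow> 'w \<Rightarrow> 'b::real_normed_vector) \<Rightarrow> bool"
  where "simple_process M F m \<tau> \<xi> \<longleftrightarrow>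
    0 \<le> \<tau> 0 \<and>
    (\<forall>k<m. \<tau> k < \<tau> (Suc k) \<and> \<xi> k \<in> borel_measurable (F (\<tau> k)) \<and> bounded (\<xi> k ` space M))"

definition simple_value ::
  "nat \<Rightarrow> (nat \<Rightarrow> real) \<Rightarrow> (nat \<Rightarrow> 'w \<Rightarrow> 'b::real_normed_vector) \<Rightarrow> real \<Rightarrow> 'w \<Rightarrow> 'b"
  where "simple_value m \<tau> \<xi> s \<omega> = (\<Sum>k<m. indicator {\<tau> k<..\<tau> (Suc k)} s *\<^sub>R \<xi> k \<omega>)"

definition simple_integral ::
  "(real \<Rightarrow> 'w \<Rightarrow> real) \<Rightarrow> nat \<Rightarrow> (nat \<Rightarrow> real) \<Rightarrow> (nat \<Rightarrow> 'w \<Rightarrow> 'b::real_normed_vector) \<Rightarrow> real \<Rightarrow> 'w \<Rightarrow> 'b"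
  where "simple_integral B m \<tau> \<xi> t \<omega> =
    (\<Sum>k<m. (B (min t (\<tau> (Suc k))) \<omega> - B (min t (\<tau> k)) \<omega>) *\<^sub>R \<xi> k \<omega>)"

text \<open>
  \<open>J\<close> is a version of the It\^o integral of \<open>H\<close> against \<open>B\<close> over the time interval from \<open>0\<close> to \<open>t\<close>:
  the limit in probability of the integrals of simple processes \<open>S\<^sub>n\<close> for which the time integral of
  \<open>\<parallel>S\<^sub>n - H\<parallel>\<^sup>2\<close> tends to \<open>0\<close> in probability.  The time integral is taken in the extended nonnegative
  reals, so such \<open>S\<^sub>n\<close> exist only if \<open>H\<close> is almost surely square integrable in time.
\<close>

definition has_ito_integral ::
  "'w measure \<Rightarrow> (real \<Rightarrow> 'w measure) \<Rightarrow> (real \<Rightarrow> 'w \<Rightarrow> real) \<Rightarrow>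
   (real \<Rightarrow> 'w \<Rightarrow> 'b::euclidean_space) \<Rightarrow> real \<Rightarrow> ('w \<Rightarrow> 'b) \<Rightarrow> bool"
  where "has_ito_integral M F B H t J \<longleftrightarrow>
    progressively_measurable F H \<and> J \<in> borel_measurable M \<and>
    (\<exists>m \<tau> \<xi>.
      (\<forall>n. simple_process M F (m n) (\<tau> n) (\<xi> n)) \<and>
      (\<forall>\<epsilon>>0. (\<lambda>n. measure M {\<omega> \<in> space M.
         (\<integral>\<^sup>+s\<in>{0..t}. ennreal ((norm (simple_value (m n) (\<tau> n) (\<xi> n) s \<omega> - H s \<omega>))\<^sup>2) \<partial>lborel) > ennreal \<epsilon>})
         \<longlonglongrightarrow> 0) \<and>
      (\<forall>\<epsilon>>0. (\<lambda>n. measure M {\<omega> \<in> space M.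
         norm (simple_integral B (m n) (\<tau> n) (\<xi> n) t \<omega> - J \<omega>) > \<epsilon>}) \<longlonglongrightarrow> 0))"

text \<open>
  \<open>X\<close> solves \<open>dX = U(X) dt + \<surd>2 \<Sum>\<^sub>i V\<^sub>i(X) dB\<^sup>i\<close>, \<open>X\<^sub>0 = x\<close>.  Requiring the integral equation almost
  surely for each fixed time is enough because the paths of \<open>X\<close> are continuous.
\<close>

definition sde_solution ::
  "'w measure \<Rightarrow> (real \<Rightarrow> 'w measure) \<Rightarrow> nat \<Rightarrow> (nat \<Rightarrow> real \<Rightarrow> 'w \<Rightarrow> real) \<Rightarrow>
   (real ^ 'n \<Rightarrow> real ^ 'n) \<Rightarrow> (nat \<Rightarrow> real ^ 'n \<Rightarrow> real ^ 'n) \<Rightarrow>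
   real ^ 'n \<Rightarrow> (real \<Rightarrow> 'w \<Rightarrow> real ^ 'n) \<Rightarrow> bool"
  where "sde_solution M F d B U V x X \<longleftrightarrow>
    filtered_prob_space M F \<and>
    independent_brownian_motions M F d B \<and>
    (\<forall>t\<ge>0. X t \<in> borel_measurable (F t)) \<and>
    (AE \<omega> in M. X 0 \<omega> = x) \<and>
    (AE \<omega> in M. continuous_on {0..} (\<lambda>t. X t \<omega>)) \<and>
    (\<exists>J. (\<forall>i\<in>{1..d}. \<forall>t\<ge>0. has_ito_integral M F (B i) (\<lambda>s \<omega>. V i (X s \<omega>)) t (J i t)) \<and>
         (\<forall>t\<ge>0. AE \<omega> in M.
            X t \<omega> = x + (LINT s:{0..t}|lborel. U (X s \<omega>)) + sqrt 2 *\<^sub>R (\<Sum>i=1..d. J i t \<omega>)))"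

end

theory Submission
  imports Defs
begin

text \<open>
  Write \<open>Q\<^sub>n\<close> and \<open>P\<^sub>t\<close> for the two semigroups.  Telescoping gives
  \<open>Q\<^sub>n f - P\<^bsub>n\<delta>\<^esub> f = (\<Sum>j<n. Q\<^bsub>n-1-j\<^esub> (Q\<^sub>1 - P\<^sub>\<delta>) P\<^bsub>j\<delta>\<^esub> f)\<close>.  By local consistency and the
  a-priori bound the \<open>j\<close>-th term is at most \<open>K\<^sub>1 \<parallel>P\<^bsub>j\<delta>\<^esub> f\<parallel> \<Phi>(x, \<delta>)\<close>, which decays geometrically in
  \<open>j\<close> by exponential stability.
\<close>

section \<open>Chapman-Kolmogorov for laws and expectations of a Markov process\<close>

lemma markov_processD:
  assumes "markov_process T M X"
  shows "prob_space (M x)"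
    and "t \<in> T \<Longrightarrow> X x t \<in> borel_measurable (M x)"
    and "AE \<omega> in M x. X x 0 \<omega> = x"
    and "t \<in> T \<Longrightarrow> law M X t \<in> borel \<rightarrow>\<^sub>M prob_algebra borel"
    and "\<lbrakk>s \<in> T; t \<in> T; A \<in> sets borel\<rbrakk> \<Longrightarrow>
      AE \<omega> in M x.
        real_cond_exp (M x) (generated (M x) {u \<in> T. u \<le> s} (X x)) (\<lambda>\<omega>'. indicator A (X x (s + t) \<omega>')) \<omega>
        = measure (law M X t (X x s \<omega>)) A"
  using assms unfolding markov_process_def by blast+

text \<open>Lets \<open>generated\<close> serve as the conditioning sigma-algebra of
  \<open>real_cond_exp\<close>.\<close>

lemma subalgebra_generated:
  assumes "\<And>t. t \<in> T \<Longrightarrow> Y t \<in> borel_measurable M"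
  shows "subalgebra M (generated M T Y)"
proof -
  have sub: "(\<Union>t\<in>T. {Y t -` A \<inter> space M |A. A \<in> sets borel}) \<subseteq> sets M"
    using measurable_sets[OF assms] by blast
  have sub': "(\<Union>t\<in>T. {Y t -` A \<inter> space M |A. A \<in> sets borel}) \<subseteq> Pow (space M)"
    by blast
  show ?thesis
    unfolding subalgebra_def generated_def
    using sets.sigma_sets_subset[OF sub] by (simp add: space_measure_of[OF sub'] sets_measure_of[OF sub'])
qed

text \<open>Chapman-Kolmogorov. The Markov property is stated through conditional expectations of
  indicators given the past up to \<open>s\<close>; integrating it over \<open>M x\<close> removes
  the conditioning, and what remains is the kernel \<open>law M X t\<close> averaged over the law at
  time \<open>s\<close>.\<close>

lemma law_add:
  assumes X: "markov_process T M X" and T: "s \<in> T" "t \<in> T" "s + t \<in> T"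
  shows "law M X (s + t) x = law M X s x \<bind> law M X t"
proof (rule measure_eqI)
  note D = markov_processD[OF X]
  interpret prob_space "M x" by (rule D)
  have [measurable]: "X x u \<in> borel_measurable (M x)" if "u \<in> T" for u
    by (rule D(2)[OF that])
  \<comment> \<open>\<open>law M X s x\<close> carries the Borel sigma-algebra, so the kernel is
    also measurable on it, as the rules for bind require.\<close>
  have law_t: "law M X t \<in> law M X s x \<rightarrow>\<^sub>M subprob_algebra borel"
    using measurable_prob_algebraD[OF D(4)[OF T(2)]] by (simp add: law_def)
  have ne: "space (law M X s x) \<noteq> {}"
    by (simp add: law_def)
  show "sets (law M X (s + t) x) = sets (law M X s x \<bind> law M X t)"
    by (simp add: sets_bind[OF sets_kernel[OF law_t] ne]) (simp add: law_def)
  fix A assume "A \<in> sets (law M X (s + t) x)"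
  then have A[measurable]: "A \<in> sets borel" by (simp add: law_def)
  let ?G = "generated (M x) {u \<in> T. u \<le> s} (X x)"
  let ?I = "\<lambda>\<omega>. indicator A (X x (s + t) \<omega>) :: real"
  let ?m = "\<lambda>\<omega>. measure (law M X t (X x s \<omega>)) A"
  interpret G: finite_measure_subalgebra "M x" ?G
    by unfold_locales (rule subalgebra_generated, simp add: D(2))
  have [measurable]: "X x s \<in> borel_measurable (M x)" "X x (s + t) \<in> borel_measurable (M x)"
    using T D(2) by auto
  have int_I: "integrable (M x) ?I"
    by (rule integrable_const_bound[where B = 1]) auto
  have m_meas: "?m \<in> borel_measurable (M x)"
    by (rule measurable_compose[OF _ measure_measurable_prob_algebra2])
       (use A D(4)[OF T(2)] in \<open>auto\<close>)
  have prob_law: "prob_space (law M X t y)" for y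
    unfolding law_def by (rule prob_space.prob_space_distr[OF D(1) D(2)[OF T(2)]])
  have "emeasure (law M X (s + t) x) A = ennreal (\<integral>\<omega>. ?I \<omega> \<partial>M x)"
  proof -
    have "emeasure (law M X (s + t) x) A = (\<integral>\<^sup>+\<omega>. ennreal (?I \<omega>) \<partial>M x)"
      unfolding law_def
      by (subst nn_integral_indicator[symmetric])
         (auto simp: nn_integral_distr ennreal_indicator simp del: nn_integral_indicator)
    also have "\<dots> = ennreal (\<integral>\<omega>. ?I \<omega> \<partial>M x)"
      by (rule nn_integral_eq_integral[OF int_I]) simp
    finally show ?thesis .
  qed
  \<comment> \<open>Tower property: conditioning preserves the integral. The Markov property then
    identifies the conditional expectation almost everywhere.\<close>
  also have "(\<integral>\<omega>. ?I \<omega> \<partial>M x) = (\<integral>\<omega>. real_cond_exp (M x) ?G ?I \<omega> \<partial>M x)"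
    by (rule G.real_cond_exp_int(2)[OF int_I, symmetric])
  also have "\<dots> = (\<integral>\<omega>. ?m \<omega> \<partial>M x)"
    by (rule integral_cong_AE) (use D(5)[OF T(1,2) A] m_meas in auto)
  also have "ennreal \<dots> = (\<integral>\<^sup>+\<omega>. ennreal (?m \<omega>) \<partial>M x)"
    by (rule nn_integral_eq_integral[symmetric])
       (auto intro!: integrable_const_bound[where B = 1] m_meas prob_space.prob_le_1 prob_law)
  \<comment> \<open>\<open>ennreal\<close> of \<open>measure\<close> is \<open>emeasure\<close>
    because every law is finite.\<close>
  also have "\<dots> = (\<integral>\<^sup>+\<omega>. emeasure (law M X t (X x s \<omega>)) A \<partial>M x)"
    using finite_measure.emeasure_eq_measure[OF prob_space.finite_measure[OF prob_law]] by simp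
  also have "\<dots> = (\<integral>\<^sup>+y. emeasure (law M X t y) A \<partial>law M X s x)"
    unfolding law_def[of M X s]
    by (rule nn_integral_distr[symmetric])
       (auto intro!: measurable_emeasure_kernel[OF measurable_prob_algebraD[OF D(4)[OF T(2)]]])
  also have "\<dots> = emeasure (law M X s x \<bind> law M X t) A"
    by (rule emeasure_bind[OF ne law_t A, symmetric])
  finally show "emeasure (law M X (s + t) x) A = emeasure (law M X s x \<bind> law M X t) A" .
qed

text \<open>Chapman-Kolmogorov tested against a possibly unbounded \<open>f\<close>: Tonelli handles
  nonnegative functions, and the general case follows by splitting into positive and negative part.
  Integrability of the inner expectation comes out of the same computation, which matters when that
  expectation is not known to lie in \<open>C2b\<close>.\<close>

lemma
  assumes X: "markov_process T M X" and T: "s \<in> T" "t \<in> T" "s + t \<in> T"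
    and f[measurable]: "f \<in> borel_measurable borel"
    and int: "\<And>y. integrable (M y) (\<lambda>\<omega>. f (X y t \<omega>))" "integrable (M x) (\<lambda>\<omega>. f (X x (s + t) \<omega>))"
  shows integrable_expect: "integrable (M x) (\<lambda>\<omega>. expect M X t f (X x s \<omega>))"
    and expect_add: "expect M X (s + t) f x = expect M X s (expect M X t f) x"
proof -
  note D = markov_processD[OF X]
  have [measurable]: "X x s \<in> borel_measurable (M x)" "X x (s + t) \<in> borel_measurable (M x)"
    using T D(2) by auto
  have key: "integrable (M x) (\<lambda>\<omega>. expect M X t g (X x s \<omega>)) \<and>
      expect M X (s + t) g x = expect M X s (expect M X t g) x"
    if g[measurable]: "g \<in> borel_measurable borel" and g0: "\<And>y. 0 \<le> g y"
      and gi: "\<And>y. integrable (M y) (\<lambda>\<omega>. g (X y t \<omega>))" "integrable (M x) (\<lambda>\<omega>. g (X x (s + t) \<omega>))"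
    for g
  proof -
    have law_t: "law M X t \<in> borel \<rightarrow>\<^sub>M subprob_algebra borel"
      using measurable_prob_algebraD[OF D(4)[OF T(2)]] .
    have nn: "(\<integral>\<^sup>+z. ennreal (g z) \<partial>law M X t y) = ennreal (expect M X t g y)" for y
      unfolding law_def expect_def
      by (subst nn_integral_distr)
         (auto simp: D(2)[OF T(2)] g0 intro!: nn_integral_eq_integral gi)
    have e0: "0 \<le> expect M X t g y" for y
      unfolding expect_def by (simp add: g0)
    \<comment> \<open>Measurability in the starting point is read off the kernel: \<open>M y\<close>
      itself varies with \<open>y\<close> without any measurable structure, but its image
      \<open>law M X t y\<close> does so measurably.\<close>
    have "(\<lambda>y. enn2real (\<integral>\<^sup>+z. ennreal (g z) \<partial>law M X t y)) \<in> borel_measurable borel"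
      by (intro borel_measurable_enn2real measurable_compose[OF law_t]
            nn_integral_measurable_subprob_algebra) simp
    then have emeas[measurable]: "expect M X t g \<in> borel_measurable borel"
      by (simp add: nn e0)
    have est0: "0 \<le> expect M X (s + t) g x"
      unfolding expect_def by (simp add: g0)
    have "ennreal (expect M X (s + t) g x) = (\<integral>\<^sup>+z. ennreal (g z) \<partial>law M X (s + t) x)"
      unfolding law_def expect_def
      by (subst nn_integral_distr) (auto simp: g0 intro!: nn_integral_eq_integral[symmetric] gi)
    also have "\<dots> = (\<integral>\<^sup>+y. \<integral>\<^sup>+z. ennreal (g z) \<partial>law M X t y \<partial>law M X s x)"
      unfolding law_add[OF X T]
      by (rule nn_integral_bind[where B = borel]) (use law_t in \<open>auto simp: law_def\<close>)
    also have "\<dots> = (\<integral>\<^sup>+\<omega>. ennreal (expect M X t g (X x s \<omega>)) \<partial>M x)"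
      unfolding nn unfolding law_def by (subst nn_integral_distr) auto
    \<comment> \<open>The right-hand side is finite, so this identity gives both integrability and
      the value of the iterated expectation.\<close>
    finally have eq: "(\<integral>\<^sup>+\<omega>. ennreal (expect M X t g (X x s \<omega>)) \<partial>M x) = ennreal (expect M X (s + t) g x)"
      by simp
    have "integrable (M x) (\<lambda>\<omega>. expect M X t g (X x s \<omega>))"
      by (rule integrableI_nonneg) (auto simp: e0 eq)
    moreover have "expect M X s (expect M X t g) x = expect M X (s + t) g x"
      unfolding expect_def[of M X s]
      by (subst integral_eq_nn_integral) (auto simp: e0 eq est0)
    ultimately show ?thesis by simp
  qed
  let ?p = "\<lambda>y. max 0 (f y)" and ?n = "\<lambda>y. max 0 (- f y)"
  have p: "integrable (M x) (\<lambda>\<omega>. expect M X t ?p (X x s \<omega>)) \<and>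
      expect M X (s + t) ?p x = expect M X s (expect M X t ?p) x"
    by (rule key) (auto intro!: integrable_max int)
  have n: "integrable (M x) (\<lambda>\<omega>. expect M X t ?n (X x s \<omega>)) \<and>
      expect M X (s + t) ?n x = expect M X s (expect M X t ?n) x"
    by (rule key) (auto intro!: integrable_max int)
  have split: "f y = ?p y - ?n y" for y by (simp add: max_def)
  have t: "expect M X t f y = expect M X t ?p y - expect M X t ?n y" for y
    unfolding expect_def
    by (subst split, rule Bochner_Integration.integral_diff) (auto intro!: integrable_max int)
  have st: "expect M X (s + t) f x = expect M X (s + t) ?p x - expect M X (s + t) ?n x"
    unfolding expect_def
    by (subst split, rule Bochner_Integration.integral_diff) (auto intro!: integrable_max int)
  show "integrable (M x) (\<lambda>\<omega>. expect M X t f (X x s \<omega>))"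
    unfolding t using p n by auto
  have "expect M X s (expect M X t f) x = expect M X s (expect M X t ?p) x - expect M X s (expect M X t ?n) x"
    unfolding expect_def[of M X s] t
    by (rule Bochner_Integration.integral_diff) (use p n in auto)
  with st p n show "expect M X (s + t) f x = expect M X s (expect M X t f) x"
    by simp
qed

lemma expect_0:
  assumes X: "markov_process T M X" and "0 \<in> T" and f[measurable]: "f \<in> borel_measurable borel"
  shows "expect M X 0 f x = f x"
proof -
  note D = markov_processD[OF X]
  interpret prob_space "M x" by (rule D)
  have [measurable]: "X x 0 \<in> borel_measurable (M x)"
    by (rule D) fact
  \<comment> \<open>The process starts at \<open>x\<close> only almost surely, hence the comparison
    of integrands up to a null set.\<close>
  have "expect M X 0 f x = (\<integral>\<omega>. f x \<partial>M x)"
    unfolding expect_def by (rule integral_cong_AE) (use D(3)[of x] in auto)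
  then show ?thesis by (simp add: prob_space)
qed

section \<open>The space \<open>C2b\<close> and a geometric sum\<close>

lemma C2b_measurable:
  fixes f :: "real ^ 'n \<Rightarrow> real"
  assumes "f \<in> C2b"
  shows "f \<in> borel_measurable borel"
proof -
  have "f differentiable (at x)" for x
    using assms by (simp add: C2b_def numeral_2_eq_2)
  then have "continuous_on UNIV f"
    by (simp add: continuous_at_imp_continuous_on differentiable_imp_continuous_within)
  then show ?thesis by (rule borel_measurable_continuous_onI)
qed

text \<open>Membership in \<open>C2b\<close> bounds the range under the supremum, so the supremum
  dominates its value at the point 0.\<close>

lemma C2b_norm_nonneg:
  fixes f :: "real ^ 'n \<Rightarrow> real"
  assumes "f \<in> C2b"
  shows "0 \<le> C2b_norm f"
proof -
  obtain a b where "\<And>x. norm (grad f x) \<le> a" "\<And>x. norm (hessian f x) \<le> b"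
    using assms by (auto simp: C2b_def bounded_iff)
  then have "bdd_above (range (\<lambda>x. norm (grad f x) + norm (hessian f x)))"
    by (intro bdd_aboveI2[where M = "a + b"] add_mono) auto
  then have "norm (grad f 0) + norm (hessian f 0) \<le> C2b_norm f"
    unfolding C2b_norm_def by (rule cSUP_upper2[where x = 0]) auto
  then show ?thesis
    by (meson add_nonneg_nonneg norm_ge_zero order_trans)
qed

text \<open>A partial geometric sum is bounded by the full series; the bound is free of
  \<open>n\<close>, which makes the final estimate uniform in time.\<close>

lemma sum_exp_le:
  fixes a :: real
  assumes "0 < a"
  shows "(\<Sum>j<n. exp (- a * real j)) \<le> 1 / (1 - exp (- a))"
proof -
  have "exp (- a * real j) = exp (- a) ^ j" for j
    by (metis exp_of_nat_mult mult.commute)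
  then have "(\<Sum>j<n. exp (- a * real j)) = (1 - exp (- a) ^ n) / (1 - exp (- a))"
    using assms by (simp add: sum_gp_strict)
  also have "\<dots> \<le> 1 / (1 - exp (- a))"
    using assms by (intro divide_right_mono) auto
  finally show ?thesis .
qed

section \<open>Uniform-in-time error of the discrete scheme\<close>

theorem proposition2p2:
  fixes U0 :: "real ^ 'n \<Rightarrow> real ^ 'n"
    and V :: "nat \<Rightarrow> real ^ 'n \<Rightarrow> real ^ 'n"
    and d :: nat
    and M :: "real ^ 'n \<Rightarrow> 'w measure"
    and F :: "real ^ 'n \<Rightarrow> real \<Rightarrow> 'w measure"
    and B :: "real ^ 'n \<Rightarrow> nat \<Rightarrow> real \<Rightarrow> 'w \<Rightarrow> real"
    and X :: "real ^ 'n \<Rightarrow> real \<Rightarrow> 'w \<Rightarrow> real ^ 'n"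
    and Q :: "real \<Rightarrow> real ^ 'n \<Rightarrow> 'v measure"
    and Y :: "real \<Rightarrow> real ^ 'n \<Rightarrow> nat \<Rightarrow> 'v \<Rightarrow> real ^ 'n"
    and \<phi> \<Phi> :: "real ^ 'n \<Rightarrow> real \<Rightarrow> real"
    and K0 K1 lam \<delta>0 :: real
  assumes smooth_U0: "smooth U0"
    and smooth_V: "\<forall>i\<in>{1..d}. smooth (V i)"
    and sde: "\<forall>x. sde_solution (M x) (F x) d (B x) U0 V x (X x)"
    and markov_X: "markov_process {0..} M X"
    and markov_Y: "\<forall>\<delta>>0. markov_process UNIV (Q \<delta>) (Y \<delta>)"
    and well_defined_X: "\<forall>f\<in>C2b. \<forall>t\<ge>0. \<forall>x. integrable (M x) (\<lambda>\<omega>. f (X x t \<omega>))"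
    and well_defined_Y: "\<forall>f\<in>C2b. \<forall>\<delta>>0. \<forall>n x. integrable (Q \<delta> x) (\<lambda>\<omega>. f (Y \<delta> x n \<omega>))"
    and constants: "K0 > 0" "lam > 0" "K1 > 0" "\<delta>0 > 0"
    and nonneg: "\<forall>x. \<forall>\<delta>>0. \<phi> x \<delta> \<ge> 0 \<and> \<Phi> x \<delta> \<ge> 0"
    and SES: "\<forall>t\<ge>0. \<forall>f\<in>C2b. expect M X t f \<in> C2b \<and>
                C2b_norm (expect M X t f) \<le> K0 * C2b_norm f * exp (- lam * t)"
    and local_consistency: "\<forall>x. \<forall>f\<in>C2b. \<forall>\<delta>>0.
                \<bar>expect (Q \<delta>) (Y \<delta>) 1 f x - expect M X \<delta> f x\<bar> \<le> K1 * C2b_norm f * \<phi> x \<delta>"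
    and phi_measurable: "\<forall>\<delta>\<in>{0<..<\<delta>0}. (\<lambda>y. \<phi> y \<delta>) \<in> borel_measurable borel"
    and a_priori: "\<forall>x. \<forall>\<delta>\<in>{0<..<\<delta>0}.
                (SUP n. \<integral>\<^sup>+\<omega>. ennreal (\<phi> (Y \<delta> x n \<omega>) \<delta>) \<partial>Q \<delta> x) \<le> ennreal (\<Phi> x \<delta>)"
  shows "\<forall>x. \<forall>f\<in>C2b. \<forall>\<delta>\<in>{0<..<\<delta>0}.
           (SUP n. ereal \<bar>expect (Q \<delta>) (Y \<delta>) n f x - expect M X (real n * \<delta>) f x\<bar>)
             \<le> ereal (K1 * max K0 1 * C2b_norm f * \<Phi> x \<delta> / (1 - exp (- lam * \<delta>)))"
proof (intro allI ballI SUP_least)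
  fix x :: "real ^ 'n" and f :: "real ^ 'n \<Rightarrow> real" and \<delta> :: real and n :: nat
  assume f: "f \<in> C2b" and \<delta>: "\<delta> \<in> {0<..<\<delta>0}"
  define P where "P t = expect M X t" for t
  define R where "R k = expect (Q \<delta>) (Y \<delta>) k" for k
  have \<delta>_pos: "0 < \<delta>" using \<delta> by simp
  have Y: "markov_process UNIV (Q \<delta>) (Y \<delta>)" using markov_Y \<delta>_pos by simp
  have \<Phi>: "0 \<le> \<Phi> x \<delta>" using nonneg \<delta>_pos by simp
  note [measurable] = markov_processD(2)[OF Y UNIV_I]
  have P_C2b: "P t g \<in> C2b" and P_norm: "C2b_norm (P t g) \<le> K0 * C2b_norm g * exp (- lam * t)"
    if "g \<in> C2b" "0 \<le> t" for g t
    using SES that by (auto simp: P_def)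
  have P_add: "P (s + t) g = P s (P t g)" if "g \<in> C2b" "0 \<le> s" "0 \<le> t" for g s t
    unfolding P_def using that well_defined_X
    by (intro ext expect_add[OF markov_X]) (auto intro: C2b_measurable)
  have P_0: "P 0 g = g" if "g \<in> C2b" for g
    unfolding P_def using that by (intro ext expect_0[OF markov_X]) (auto intro: C2b_measurable)

  have int_\<phi>: "integrable (Q \<delta> x) (\<lambda>\<omega>. \<phi> (Y \<delta> x k \<omega>) \<delta>)"
    and E_\<phi>: "(\<integral>\<omega>. \<phi> (Y \<delta> x k \<omega>) \<delta> \<partial>Q \<delta> x) \<le> \<Phi> x \<delta>" for k
  proof -
    have [measurable]: "(\<lambda>y. \<phi> y \<delta>) \<in> borel_measurable borel"
      using phi_measurable \<delta> by blast
    have \<phi>0: "0 \<le> \<phi> y \<delta>" for y using nonneg \<delta>_pos by simp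
    have le: "(\<integral>\<^sup>+\<omega>. ennreal (\<phi> (Y \<delta> x k \<omega>) \<delta>) \<partial>Q \<delta> x) \<le> ennreal (\<Phi> x \<delta>)"
      using a_priori \<delta> by (meson SUP_le_iff UNIV_I)
    \<comment> \<open>\<open>a_priori\<close> bounds an extended integral, whose finiteness gives
      integrability and transfers the bound to the Bochner integral.\<close>
    show i: "integrable (Q \<delta> x) (\<lambda>\<omega>. \<phi> (Y \<delta> x k \<omega>) \<delta>)"
      by (rule integrableI_nonneg) (use le in \<open>auto simp: \<phi>0 intro: le_less_trans\<close>)
    show "(\<integral>\<omega>. \<phi> (Y \<delta> x k \<omega>) \<delta> \<partial>Q \<delta> x) \<le> \<Phi> x \<delta>"
      using le \<Phi> by (simp add: nn_integral_eq_integral[OF i] \<phi>0)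
  qed

  \<comment> \<open>One local error, made at time \<open>k\<close> and averaged over the position of
    the discrete chain.\<close>
  have step: "\<bar>R k (R 1 g) x - R k (P \<delta> g) x\<bar> \<le> K1 * C2b_norm g * \<Phi> x \<delta>"
    if g: "g \<in> C2b" for g k
  proof -
    \<comment> \<open>\<open>R 1 g\<close> is not known to lie in \<open>C2b\<close>, so
      integrability comes from Chapman-Kolmogorov for the chain; for \<open>P \<delta> g\<close>
      below, membership in \<open>C2b\<close> suffices.\<close>
    have i1: "integrable (Q \<delta> x) (\<lambda>\<omega>. R 1 g (Y \<delta> x k \<omega>))"
      unfolding R_def using g well_defined_Y \<delta>_pos
      by (intro integrable_expect[OF Y]) (auto intro: C2b_measurable)
    have i2: "integrable (Q \<delta> x) (\<lambda>\<omega>. P \<delta> g (Y \<delta> x k \<omega>))"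
      using well_defined_Y P_C2b[OF g] \<delta>_pos by simp
    have "\<bar>R k (R 1 g) x - R k (P \<delta> g) x\<bar>
        = \<bar>\<integral>\<omega>. R 1 g (Y \<delta> x k \<omega>) - P \<delta> g (Y \<delta> x k \<omega>) \<partial>Q \<delta> x\<bar>"
      unfolding R_def expect_def[of _ _ k]
      by (subst Bochner_Integration.integral_diff) (use i1 i2 in \<open>auto simp: R_def\<close>)
    also have "\<dots> \<le> (\<integral>\<omega>. \<bar>R 1 g (Y \<delta> x k \<omega>) - P \<delta> g (Y \<delta> x k \<omega>)\<bar> \<partial>Q \<delta> x)"
      by (rule integral_abs_bound)
    \<comment> \<open>Local consistency is used with the random point
      \<open>Y \<delta> x k \<omega>\<close> as starting point.\<close>
    also have "\<dots> \<le> (\<integral>\<omega>. K1 * C2b_norm g * \<phi> (Y \<delta> x k \<omega>) \<delta> \<partial>Q \<delta> x)"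
      by (rule integral_mono)
         (use i1 i2 int_\<phi> local_consistency g \<delta>_pos in \<open>auto simp: R_def P_def\<close>)
    also have "\<dots> = K1 * C2b_norm g * (\<integral>\<omega>. \<phi> (Y \<delta> x k \<omega>) \<delta> \<partial>Q \<delta> x)"
      by simp
    also have "\<dots> \<le> K1 * C2b_norm g * \<Phi> x \<delta>"
      using constants C2b_norm_nonneg[OF g] E_\<phi> by (intro mult_left_mono) auto
    finally show ?thesis .
  qed

  \<comment> \<open>The function stays arbitrary in the induction: the hypothesis is applied to
    \<open>P \<delta> g\<close>, which is again in \<open>C2b\<close>.\<close>
  have telescope: "\<bar>R k g x - P (real k * \<delta>) g x\<bar>
      \<le> (\<Sum>j<k. K1 * C2b_norm (P (real j * \<delta>) g) * \<Phi> x \<delta>)" if "g \<in> C2b" for g k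
    using that
  proof (induction k arbitrary: g)
    case 0
    have "R 0 g x = g x"
      unfolding R_def by (rule expect_0[OF Y UNIV_I C2b_measurable[OF 0]])
    then show ?case by (simp add: P_0[OF 0])
  next
    case (Suc k)
    have shift: "P (real j * \<delta>) (P \<delta> g) = P (real (Suc j) * \<delta>) g" for j
      using P_add[OF Suc.prems, of "real j * \<delta>" \<delta>] \<delta>_pos by (simp add: algebra_simps)
    have "R (Suc k) g x = R k (R 1 g) x"
      unfolding R_def using expect_add[OF Y, of k 1 g x] Suc.prems well_defined_Y \<delta>_pos
      by (auto simp: C2b_measurable)
    \<comment> \<open>The first step of each operator product is peeled off and
      \<open>R k (P \<delta> g) x\<close> inserted between the two.\<close>
    then have "\<bar>R (Suc k) g x - P (real (Suc k) * \<delta>) g x\<bar>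
        \<le> \<bar>R k (R 1 g) x - R k (P \<delta> g) x\<bar> + \<bar>R k (P \<delta> g) x - P (real k * \<delta>) (P \<delta> g) x\<bar>"
      unfolding shift by linarith
    \<comment> \<open>The new error involves \<open>g\<close> itself, written as
      \<open>P (real 0 * \<delta>) g\<close> to become the term of index 0; the terms from the
      hypothesis move up by one index through \<open>shift\<close>.\<close>
    also have "\<dots> \<le> K1 * C2b_norm (P (real 0 * \<delta>) g) * \<Phi> x \<delta>
        + (\<Sum>j<k. K1 * C2b_norm (P (real (Suc j) * \<delta>) g) * \<Phi> x \<delta>)"
      using step[OF Suc.prems, of k] Suc.IH[OF P_C2b[OF Suc.prems], of \<delta>] \<delta>_pos
      unfolding shift by (intro add_mono) (simp_all add: P_0[OF Suc.prems])
    also have "\<dots> = (\<Sum>j<Suc k. K1 * C2b_norm (P (real j * \<delta>) g) * \<Phi> x \<delta>)"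
      by (simp only: sum.lessThan_Suc_shift)
    finally show ?case .
  qed

  have f0: "0 \<le> C2b_norm f" by (rule C2b_norm_nonneg[OF f])
  have "\<bar>R n f x - P (real n * \<delta>) f x\<bar> \<le> (\<Sum>j<n. K1 * C2b_norm (P (real j * \<delta>) f) * \<Phi> x \<delta>)"
    by (rule telescope[OF f])
  \<comment> \<open>Exponential stability at time \<open>real j * \<delta>\<close> yields a
    geometric term; passing from \<open>K0\<close> to \<open>max K0 1\<close> only enlarges the
    bound, since the seminorm is nonnegative.\<close>
  also have "\<dots> \<le> (\<Sum>j<n. K1 * (max K0 1 * C2b_norm f * exp (- (lam * \<delta>) * real j)) * \<Phi> x \<delta>)"
  proof (intro sum_mono mult_right_mono mult_left_mono)
    fix j
    have "C2b_norm (P (real j * \<delta>) f) \<le> K0 * C2b_norm f * exp (- lam * (real j * \<delta>))"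
      using \<delta>_pos by (intro P_norm[OF f]) simp
    also have "\<dots> \<le> max K0 1 * C2b_norm f * exp (- lam * (real j * \<delta>))"
      using f0 by (intro mult_right_mono) auto
    finally show "C2b_norm (P (real j * \<delta>) f) \<le> max K0 1 * C2b_norm f * exp (- (lam * \<delta>) * real j)"
      by (simp add: mult_ac)
  qed (use constants \<Phi> in auto)
  also have "\<dots> = K1 * max K0 1 * C2b_norm f * \<Phi> x \<delta> * (\<Sum>j<n. exp (- (lam * \<delta>) * real j))"
    by (simp add: sum_distrib_left mult_ac)
  \<comment> \<open>The geometric sum has rate \<open>lam * \<delta>\<close>, positive for fixed
    \<delta>, and supplies the denominator of the claim.\<close>
  also have "\<dots> \<le> K1 * max K0 1 * C2b_norm f * \<Phi> x \<delta> * (1 / (1 - exp (- (lam * \<delta>))))"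
    using constants \<delta>_pos f0 \<Phi> by (intro mult_left_mono sum_exp_le) auto
  finally show "ereal \<bar>expect (Q \<delta>) (Y \<delta>) n f x - expect M X (real n * \<delta>) f x\<bar>
      \<le> ereal (K1 * max K0 1 * C2b_norm f * \<Phi> x \<delta> / (1 - exp (- lam * \<delta>)))"
    by (simp add: R_def P_def)
qed

end
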